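(* Let $\kappa>0$, $n\ge2$, $m_1,\dots,m_n>0$. Let $(\mathbf q,\mathbf p)$ be an analytic solution of the equations of motion of the curved $n$-body problem in the hemisphere $z>0$ of $\mathbf S^2_\kappa$ that encounters a total collision at time $t^*$ at the north pole $(0,0,\kappa^{-1/2})$ and is free of pole-geodesic configurations in some interval $[t_0,t^* )$. Then the constant total angular momentum vector $\mathbf c=(\alpha,\beta,\gamma)=\sum_{i=1}^n\mathbf q_i\times\mathbf p_i$ of this solution has $\gamma=0$.
   Context: $\mathbf S^2_\kappa=\{(x,y,z)\in\mathbb R^3:\kappa(x^2+y^2+z^2)=1\}$, and $\cdot$, $\times$ are the standard inner and cross products of $\mathbb R^3$. The bodies of masses $m_i$ have positions $\mathbf q_i=(x_i,y_i,z_i)\in\mathbf S^2_\kappa$ with $z_i>0$ and momenta $\mathbf p_i$, subject to $\kappa\,\mathbf q_i\cdot\mathbf q_i=1$ and $\mathbf q_i\cdot\mathbf p_i=0$; $\mathbf q=(\mathbf q_1,\dots,\mathbf q_n)$, $\mathbf p=(\mathbf p_1,\dots,\mathbf p_n)$. The equations of motion are $$\dot{\mathbf q}_i=m_i^{-1}\mathbf p_i,\qquad \dot{\mathbf p}_i=\nabla_{\mathbf q_i}U_\kappa(\mathbf q)-m_i^{-1}\kappa(\mathbf p_i\cdot\mathbf p_i)\mathbf q_i,\qquad i=1,\dots,n,$$ where $$U_\kappa(\mathbf q)=\frac12\sum_{i=1}^n\sum_{j\ne i}\frac{m_im_j\,\kappa^{1/2}\,\kappa\mathbf q_i\cdot\mathbf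 q_j}{[(\kappa\mathbf q_i\cdot\mathbf q_i)(\kappa\mathbf q_j\cdot\mathbf q_j)-(\kappa\mathbf q_i\cdot\mathbf q_j)^2]^{1/2}}.$$ The equations are undefined where $(\kappa\mathbf q_i\cdot\mathbf q_j)^2=1$ for some $i<j$, and a solution avoids such configurations for times before $t^*$. The vector $\sum_i\mathbf q_i\times\mathbf p_i$ is constant along solutions. A total collision at time $t^*$ ($<\infty$) at the north pole means that $\mathbf q_i(t)\to(0,0,\kappa^{-1/2})$ as $t\to t^*$ for all $i$. A pole-geodesic configuration is one in which two or more bodies lie on a common geodesic (great circle) through the north pole, i.e. $(x_i,y_i)$ and $(x_j,y_j)$ are linearly dependent for some $i\ne j$. *)

theory Defs
  imports "HOL-Analysis.Analysis"
begin

text \<open>Bodies carry the indices \<open>1, \<dots>, n\<close>. A configuration is a function \<open>Q :: nat \<Rightarrow> real^3\<close>, of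
  which only the values at these indices matter; a motion is a function of time with values
  in configurations.\<close>

text \<open>The potential is taken on (part of) the ambient space, not on the sphere only: its gradient
  in the equations of motion is the ambient one, so the factors \<open>\<kappa> * (Q i \<bullet> Q i)\<close>, which
  equal 1 on the sphere, have to be kept.\<close>

definition curved_potential :: "real \<Rightarrow> nat \<Rightarrow> (nat \<Rightarrow> real) \<Rightarrow> (nat \<Rightarrow> real^3) \<Rightarrow> real" where
  "curved_potential \<kappa> n m Q =
     (1/2) * (\<Sum>i\<in>{1..n}. \<Sum>j\<in>{1..n} - {i}.
        m i * m j * sqrt \<kappa> * (\<kappa> * (Q i \<bullet> Q j)) /
        sqrt ((\<kappa> * (Q i \<bullet> Q i)) * (\<kappa> * (Q j \<bullet> Q j)) - (\<kappa> * (Q i \<bullet> Q j))\<^sup>2))"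

text \<open>Unspecified where the function is not differentiable.\<close>

definition gradient :: "('a::real_inner \<Rightarrow> real) \<Rightarrow> 'a \<Rightarrow> 'a" where
  "gradient f x = (THE D. GDERIV f x :> D)"

lemma gradient_eqI:
  assumes "GDERIV f x :> D"
  shows "gradient f x = D"
  unfolding gradient_def
proof (rule the_equality)
  fix D' assume "GDERIV f x :> D'"
  with assms have "(\<lambda>h. h \<bullet> D') = (\<lambda>h. h \<bullet> D)"
    unfolding gderiv_def by (intro has_derivative_unique)
  then show "D' = D"
    by (metis vector_eq_ldot)
qed (fact assms)

definition grad_body ::
  "((nat \<Rightarrow> real^3) \<Rightarrow> real) \<Rightarrow> nat \<Rightarrow> (nat \<Rightarrow> real^3) \<Rightarrow> real^3" where
  "grad_body U i Q = gradient (\<lambda>x. U (Q(i := x))) (Q i)"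

definition singular_configuration :: "real \<Rightarrow> nat \<Rightarrow> (nat \<Rightarrow> real^3) \<Rightarrow> bool" where
  "singular_configuration \<kappa> n Q \<longleftrightarrow>
     (\<exists>i\<in>{1..n}. \<exists>j\<in>{1..n}. i < j \<and> (\<kappa> * (Q i \<bullet> Q j))\<^sup>2 = 1)"

text \<open>If the set of times \<open>J\<close> is an interval that contains an endpoint, the derivatives there are
  one-sided.\<close>

definition curved_nbody_solution ::
  "real \<Rightarrow> nat \<Rightarrow> (nat \<Rightarrow> real) \<Rightarrow> real set \<Rightarrow>
   (real \<Rightarrow> nat \<Rightarrow> real^3) \<Rightarrow> (real \<Rightarrow> nat \<Rightarrow> real^3) \<Rightarrow> bool" where
  "curved_nbody_solution \<kappa> n m J q p \<longleftrightarrow>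
     (\<forall>t\<in>J. \<not> singular_configuration \<kappa> n (q t) \<and>
       (\<forall>i\<in>{1..n}.
          \<kappa> * (q t i \<bullet> q t i) = 1 \<and>
          q t i \<bullet> p t i = 0 \<and>
          ((\<lambda>s. q s i) has_vector_derivative (1 / m i) *\<^sub>R p t i) (at t within J) \<and>
          ((\<lambda>s. p s i) has_vector_derivative
             grad_body (curved_potential \<kappa> n m) i (q t)
               - ((1 / m i) * \<kappa> * (p t i \<bullet> p t i)) *\<^sub>R q t i) (at t within J)))"

text \<open>At a point of \<open>J\<close> that is not interior, this asks for a power series that represents \<open>f\<close> on
  the part of \<open>J\<close> near that point.\<close>

definition real_analytic_on :: "(real \<Rightarrow> 'a::real_normed_vector) \<Rightarrow> real set \<Rightarrow> bool" where
  "real_analytic_on f J \<longleftrightarrow>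
     (\<forall>t\<in>J. \<exists>r>0. \<exists>c. \<forall>s\<in>J. \<bar>s - t\<bar> < r \<longrightarrow> (\<lambda>k. (s - t) ^ k *\<^sub>R c k) sums f s)"

definition north_pole :: "real \<Rightarrow> real^3" where
  "north_pole \<kappa> = vector [0, 0, 1 / sqrt \<kappa>]"

definition total_collision_at_north_pole ::
  "real \<Rightarrow> nat \<Rightarrow> (real \<Rightarrow> nat \<Rightarrow> real^3) \<Rightarrow> real \<Rightarrow> bool" where
  "total_collision_at_north_pole \<kappa> n q ts \<longleftrightarrow>
     (\<forall>i\<in>{1..n}. ((\<lambda>t. q t i) \<longlongrightarrow> north_pole \<kappa>) (at_left ts))"

text \<open>Linear dependence is that of the family \<open>(x\<^sub>i, y\<^sub>i), (x\<^sub>j, y\<^sub>j)\<close>. It is written out because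
  \<open>dependent {v, w}\<close> speaks of a set, which is independent if \<open>v = w \<noteq> 0\<close>.\<close>

definition pole_geodesic_configuration :: "nat \<Rightarrow> (nat \<Rightarrow> real^3) \<Rightarrow> bool" where
  "pole_geodesic_configuration n Q \<longleftrightarrow>
     (\<exists>i\<in>{1..n}. \<exists>j\<in>{1..n}. i \<noteq> j \<and>
        (\<exists>a b. (a \<noteq> 0 \<or> b \<noteq> 0) \<and>
           a *\<^sub>R (Q i $ 1, Q i $ 2) + b *\<^sub>R (Q j $ 1, Q j $ 2) = 0))"

definition angular_momentum :: "nat \<Rightarrow> (nat \<Rightarrow> real^3) \<Rightarrow> (nat \<Rightarrow> real^3) \<Rightarrow> real^3" where
  "angular_momentum n Q P = (\<Sum>i\<in>{1..n}. cross3 (Q i) (P i))"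

end

theory Submission
  imports Defs
begin

text \<open>The proof is Sundman's argument against a total collapse with nonzero angular momentum, carried
over from the plane to a neighbourhood of the pole. Three quantities play the roles that they
have in the plane. In place of the moment of inertia stands the mass-weighted sum \<open>D\<close> of the
depths \<open>1/\<surd>\<kappa> - z\<^sub>a\<close> below the pole, divided by \<open>\<surd>\<kappa>\<close>; to leading order it is half the moment
of inertia about the polar axis, and it tends to 0 at the collision. The kinetic energy is \<open>K\<close>,
and the energy \<open>h = K - V\<close> is conserved, where \<open>V\<close> is the cotangent potential on the sphere.

First, a Lagrange-Jacobi inequality. Summing the vertical components of the equations of motion
and pairing the mutual attractions shows that near the pole \<open>D''\<close> is \<open>2 K - V\<close> up to relative
errors of both terms that vanish at the pole. Since \<open>V = K - h\<close>, already a crude control of these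
errors leaves \<open>D'' \<ge> K/2 + 5 h/4\<close> (\<open>polar_acceleration_ge\<close>). It matters that
\<open>V\<close> is removed by conservation of energy, since \<open>V\<close> is unbounded at the collision.

Second, the Cauchy-Schwarz inequality gives \<open>\<gamma>\<^sup>2 \<le> 4 D K\<close> for the polar component \<open>\<gamma>\<close> of the angular
momentum (\<open>angular_momentum_square_le\<close>). Only this component profits from the smallness of \<open>D\<close>,
because only it has the distances to the polar axis as lever arms.

Together, if \<open>\<gamma> \<noteq> 0\<close>, then \<open>D > 0\<close> and \<open>D'' \<ge> (\<gamma>\<^sup>2/8) / D - C\<close>. But a repulsion of strength \<open>1/D\<close> has
a logarithmic potential, which is unbounded at \<open>D = 0\<close>, so that \<open>D\<close> cannot reach 0 in finite time
(\<open>no_collapse_of_repulsion\<close>).\<close>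

section \<open>A repulsion that is never overcome\<close>

text \<open>Newton's equation \<open>f'' = c/f - C\<close> has the energy \<open>g\<^sup>2/2 - c ln f + C f\<close> with \<open>g = f'\<close>. Under the
inequality its rate of change is \<open>g\<close> times a nonnegative quantity, so it does not increase while
\<open>f\<close> falls; near the end \<open>f\<close> does fall, being positive and convex there with limit 0. A bounded energy however
keeps \<open>ln f\<close> bounded below.\<close>

lemma no_collapse_of_repulsion:
  fixes f g g' :: "real \<Rightarrow> real"
  assumes ab: "a < b" and c: "c > 0"
    and f: "\<And>t. a < t \<Longrightarrow> t < b \<Longrightarrow> (f has_real_derivative g t) (at t)"
    and g: "\<And>t. a < t \<Longrightarrow> t < b \<Longrightarrow> (g has_real_derivative g' t) (at t)"
    and pos: "\<And>t. a < t \<Longrightarrow> t < b \<Longrightarrow> f t > 0"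
    and bound: "\<And>t. a < t \<Longrightarrow> t < b \<Longrightarrow> g' t \<ge> c / f t - C"
    and lim: "(f \<longlongrightarrow> 0) (at_left b)"
  shows False
proof -
  have "\<forall>\<^sub>F t in at_left b. f t < c / (\<bar>C\<bar> + 1)"
    using lim c by (intro order_tendstoD) auto
  then obtain e where e: "e < b" "\<And>t. e < t \<Longrightarrow> t < b \<Longrightarrow> f t < c / (\<bar>C\<bar> + 1)"
    by (auto simp: eventually_at_left_field)
  define u where "u = (max a e + b) / 2"
  have u: "a < u" "e < u" "u < b" using ab e(1) by (auto simp: u_def)
  \<comment> \<open>Beyond \<open>u\<close> the repulsion exceeds \<open>C\<close>, whatever its sign, so \<open>f\<close> is strictly convex.\<close>
  have g'_pos: "g' t > 0" if "u \<le> t" "t < b" for t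
  proof -
    have t: "a < t" "e < t" using that u by auto
    have "f t * (\<bar>C\<bar> + 1) < c"
      using e(2)[OF t(2) that(2)] by (simp add: pos_less_divide_eq)
    then have "\<bar>C\<bar> + 1 < c / f t"
      using pos[OF t(1) that(2)] by (simp add: pos_less_divide_eq mult.commute)
    then show ?thesis using bound[OF t(1) that(2)] by linarith
  qed
  \<comment> \<open>A convex function that has stopped falling cannot approach 0 from positive values.\<close>
  have g_neg: "g t < 0" if t: "u \<le> t" "t < b" for t
  proof (rule ccontr)
    assume "\<not> g t < 0"
    then have gt: "g t \<ge> 0" by simp
    have g_nonneg: "g s \<ge> 0" if "t \<le> s" "s < b" for s
    proof -
      have "g t \<le> g s"
      proof (rule DERIV_nonneg_imp_nondecreasing[OF that(1)])
        fix x assume "t \<le> x" "x \<le> s"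
        then show "\<exists>y. DERIV g x :> y \<and> 0 \<le> y"
          using g[of x] g'_pos[of x] t that u by (intro exI[of _ "g' x"]) auto
      qed
      then show ?thesis using gt by simp
    qed
    have "f t \<le> f s" if "t \<le> s" "s < b" for s
    proof (rule DERIV_nonneg_imp_nondecreasing[OF that(1)])
      fix x assume "t \<le> x" "x \<le> s"
      then show "\<exists>y. DERIV f x :> y \<and> 0 \<le> y"
        using f[of x] g_nonneg[of x] t that u by (intro exI[of _ "g x"]) auto
    qed
    then have "\<forall>\<^sub>F s in at_left b. f t \<le> f s"
      using t by (auto simp: eventually_at_left_field intro!: exI[of _ t])
    then have "f t \<le> 0"
      using lim by (intro tendsto_lowerbound[where F = "at_left b"]) auto
    then show False using pos[of t] t u by auto
  qed
  define H where "H = (\<lambda>t. (g t)\<^sup>2 / 2 - c * ln (f t) + C * f t)"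
  have H_mono: "H t \<le> H u" if t: "u \<le> t" "t < b" for t
  proof (rule DERIV_nonpos_imp_nonincreasing[OF t(1)])
    fix x assume x: "u \<le> x" "x \<le> t"
    have fx: "f x > 0" and gx: "g x < 0" and bx: "g' x - c / f x + C \<ge> 0"
      using pos[of x] g_neg[of x] bound[of x] x t u by auto
    have "(H has_real_derivative g x * (g' x - c / f x + C)) (at x)"
      unfolding H_def using f[of x] g[of x] x t u fx
      by (auto intro!: derivative_eq_intros simp: algebra_simps)
    moreover have "g x * (g' x - c / f x + C) \<le> 0"
      using gx bx by (intro mult_nonpos_nonneg) auto
    ultimately show "\<exists>y. DERIV H x :> y \<and> y \<le> 0" by blast
  qed
  \<comment> \<open>Solving the energy bound for \<open>ln f\<close>, with \<open>C f\<close> bounded in absolute value, gives a positive lower bound of \<open>f\<close>.\<close>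
  define B where "B = exp (- (H u + \<bar>C\<bar> * (c / (\<bar>C\<bar> + 1))) / c)"
  have "B \<le> f t" if t: "u < t" "t < b" for t
  proof -
    have ft: "f t > 0" "f t < c / (\<bar>C\<bar> + 1)" using pos[of t] e(2)[of t] t u by auto
    have "- c * ln (f t) + C * f t \<le> H u"
      using H_mono[of t] t zero_le_power2[of "g t"] unfolding H_def by linarith
    moreover have "- (\<bar>C\<bar> * (c / (\<bar>C\<bar> + 1))) \<le> C * f t"
    proof -
      have "- (C * f t) \<le> \<bar>C\<bar> * f t" using ft
        by (metis abs_ge_minus_self abs_mult abs_of_pos)
      also have "\<dots> \<le> \<bar>C\<bar> * (c / (\<bar>C\<bar> + 1))" using ft by (intro mult_left_mono) auto
      finally show ?thesis by simp
    qed
    ultimately have "- (H u + \<bar>C\<bar> * (c / (\<bar>C\<bar> + 1))) \<le> ln (f t) * c"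
      by (simp add: mult.commute)
    then have "- (H u + \<bar>C\<bar> * (c / (\<bar>C\<bar> + 1))) / c \<le> ln (f t)"
      using c by (simp only: pos_divide_le_eq)
    then show ?thesis unfolding B_def using ft by (simp add: ln_ge_iff)
  qed
  then have "\<forall>\<^sub>F t in at_left b. B \<le> f t"
    using u by (auto simp: eventually_at_left_field)
  then have "B \<le> 0"
    using lim by (intro tendsto_lowerbound[where F = "at_left b"]) auto
  then show False by (simp add: B_def)
qed

section \<open>The force on a body\<close>

text \<open>One summand of the potential, without the masses. It does not change when an argument is multiplied
by a positive number, hence its ambient gradient is tangent to the sphere.\<close>

definition pair_potential :: "real \<Rightarrow> real^3 \<Rightarrow> real^3 \<Rightarrow> real" where
  "pair_potential \<kappa> x y = sqrt \<kappa> * (\<kappa> * (x \<bullet> y)) /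
     sqrt ((\<kappa> * (x \<bullet> x)) * (\<kappa> * (y \<bullet> y)) - (\<kappa> * (x \<bullet> y))\<^sup>2)"

lemma cos_angle_square_le_1:
  fixes x y :: "'a::real_inner"
  assumes "\<kappa> * (x \<bullet> x) = 1" "\<kappa> * (y \<bullet> y) = 1"
  shows "(\<kappa> * (x \<bullet> y))\<^sup>2 \<le> 1"
proof -
  have "\<kappa>\<^sup>2 * (x \<bullet> y)\<^sup>2 \<le> \<kappa>\<^sup>2 * ((x \<bullet> x) * (y \<bullet> y))"
    by (intro mult_left_mono Cauchy_Schwarz_ineq) auto
  also have "\<dots> = (\<kappa> * (x \<bullet> x)) * (\<kappa> * (y \<bullet> y))" by (simp add: power2_eq_square)
  finally show ?thesis using assms by (simp add: power_mult_distrib)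
qed

text \<open>With \<open>c = \<kappa> (x \<bullet> y)\<close> and \<open>s\<^sup>2 = 1 - c\<^sup>2\<close>, the cosine and the squared sine of the angle between the
two positions, the quotient rule produces the coefficient \<open>s\<^sup>2 + c\<^sup>2 = 1\<close> in front of \<open>y\<close>. The
gradient is the attraction along the geodesic towards \<open>y\<close>, of magnitude proportional to \<open>1/s\<^sup>2\<close>.\<close>

lemma GDERIV_pair_potential:
  assumes "\<kappa> > 0" "\<kappa> * (x \<bullet> x) = 1" "\<kappa> * (y \<bullet> y) = 1" "(\<kappa> * (x \<bullet> y))\<^sup>2 \<noteq> 1"
  shows "GDERIV (\<lambda>x. pair_potential \<kappa> x y) x :>
    (\<kappa> * sqrt \<kappa> / sqrt (1 - (\<kappa> * (x \<bullet> y))\<^sup>2) ^ 3) *\<^sub>R (y - (\<kappa> * (x \<bullet> y)) *\<^sub>R x)"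
proof -
  define c where "c = \<kappa> * (x \<bullet> y)"
  define s where "s = sqrt (1 - c\<^sup>2)"
  have c: "c\<^sup>2 < 1" using cos_angle_square_le_1[OF assms(2,3)] assms(4) by (simp add: c_def)
  then have s: "s > 0" "s\<^sup>2 = 1 - c\<^sup>2" by (auto simp: s_def)
  have arg: "((\<lambda>z. (\<kappa> * (z \<bullet> z)) * (\<kappa> * (y \<bullet> y)) - (\<kappa> * (z \<bullet> y))\<^sup>2) has_derivative
      (\<lambda>h. 2 * \<kappa> * (h \<bullet> x) - 2 * c * (\<kappa> * (h \<bullet> y)))) (at x)"
    using assms by (auto intro!: derivative_eq_intros simp: c_def inner_commute power2_eq_square algebra_simps)
  have val: "(\<kappa> * (x \<bullet> x)) * (\<kappa> * (y \<bullet> y)) - (\<kappa> * (x \<bullet> y))\<^sup>2 = 1 - c\<^sup>2"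
    using assms by (simp add: c_def)
  have root: "((\<lambda>z. sqrt ((\<kappa> * (z \<bullet> z)) * (\<kappa> * (y \<bullet> y)) - (\<kappa> * (z \<bullet> y))\<^sup>2)) has_derivative
      (\<lambda>h. (\<kappa> * (h \<bullet> x) - c * (\<kappa> * (h \<bullet> y))) / s)) (at x)"
  proof (rule has_derivative_eq_rhs[OF has_derivative_real_sqrt[OF _ arg]])
    show "0 < (\<kappa> * (x \<bullet> x)) * (\<kappa> * (y \<bullet> y)) - (\<kappa> * (x \<bullet> y))\<^sup>2"
      unfolding val using c by simp
  qed (unfold val s_def[symmetric], use s(1) in \<open>simp add: fun_eq_iff field_simps\<close>)
  have num: "((\<lambda>z. sqrt \<kappa> * (\<kappa> * (z \<bullet> y))) has_derivative (\<lambda>h. sqrt \<kappa> * (\<kappa> * (h \<bullet> y)))) (at x)"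
    by (auto intro!: derivative_eq_intros)
  have nz: "sqrt ((\<kappa> * (x \<bullet> x)) * (\<kappa> * (y \<bullet> y)) - (\<kappa> * (x \<bullet> y))\<^sup>2) \<noteq> 0"
    unfolding val using c by simp
  have "((\<lambda>z. pair_potential \<kappa> z y) has_derivative
      (\<lambda>h. h \<bullet> ((\<kappa> * sqrt \<kappa> / s ^ 3) *\<^sub>R (y - c *\<^sub>R x)))) (at x)"
    unfolding pair_potential_def
  proof (rule has_derivative_eq_rhs[OF has_derivative_divide'[OF num root nz]], rule ext)
    fix h
    have e: "sqrt ((\<kappa> * (x \<bullet> x)) * (\<kappa> * (y \<bullet> y)) - (\<kappa> * (x \<bullet> y))\<^sup>2) = s"
      unfolding val s_def ..
    have "(sqrt \<kappa> * (\<kappa> * (h \<bullet> y)) * s - sqrt \<kappa> * c * ((\<kappa> * (h \<bullet> x) - c * (\<kappa> * (h \<bullet> y))) / s)) / (s * s)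
        = sqrt \<kappa> * \<kappa> * ((h \<bullet> y) * (s\<^sup>2 + c\<^sup>2) - c * (h \<bullet> x)) / s ^ 3"
      using s(1) by (simp add: divide_simps power2_eq_square power3_eq_cube) (simp add: algebra_simps)
    also have "\<dots> = h \<bullet> ((\<kappa> * sqrt \<kappa> / s ^ 3) *\<^sub>R (y - c *\<^sub>R x))"
      unfolding s(2) by (simp add: inner_diff_right algebra_simps diff_divide_distrib add_divide_distrib)
    finally show "(sqrt \<kappa> * (\<kappa> * (h \<bullet> y)) * sqrt ((\<kappa> * (x \<bullet> x)) * (\<kappa> * (y \<bullet> y)) - (\<kappa> * (x \<bullet> y))\<^sup>2)
       - sqrt \<kappa> * (\<kappa> * (x \<bullet> y)) * ((\<kappa> * (h \<bullet> x) - c * (\<kappa> * (h \<bullet> y))) / s)) /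
        (sqrt ((\<kappa> * (x \<bullet> x)) * (\<kappa> * (y \<bullet> y)) - (\<kappa> * (x \<bullet> y))\<^sup>2) *
         sqrt ((\<kappa> * (x \<bullet> x)) * (\<kappa> * (y \<bullet> y)) - (\<kappa> * (x \<bullet> y))\<^sup>2))
       = h \<bullet> ((\<kappa> * sqrt \<kappa> / s ^ 3) *\<^sub>R (y - c *\<^sub>R x))"
      unfolding e by (simp add: c_def)
  qed
  then show ?thesis by (simp add: gderiv_def c_def s_def)
qed

text \<open>Each unordered pair that contains \<open>i\<close> occurs twice in the double sum, which cancels the factor
\<open>1/2\<close>. The remaining pairs form a constant, so the gradient with respect to one body is a single
sum.\<close>

lemma curved_potential_fun_upd:
  assumes i: "i \<in> {1..n}"
  shows "curved_potential \<kappa> n m (Q(i := x)) =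
    (1/2) * (\<Sum>a\<in>{1..n} - {i}. \<Sum>b\<in>{1..n} - {a} - {i}. m a * m b * pair_potential \<kappa> (Q a) (Q b))
    + (\<Sum>b\<in>{1..n} - {i}. m i * m b * pair_potential \<kappa> x (Q b))"
proof -
  let ?R = "Q(i := x)" and ?A = "{1..n}"
  let ?f = "\<lambda>a b. m a * m b * pair_potential \<kappa> (?R a) (?R b)"
  have sym: "?f a b = ?f b a" for a b
    by (simp add: pair_potential_def inner_commute mult.commute)
  have "curved_potential \<kappa> n m ?R = (1/2) * (\<Sum>a\<in>?A. \<Sum>b\<in>?A - {a}. ?f a b)"
    by (simp add: curved_potential_def pair_potential_def mult.assoc)
  also have "(\<Sum>a\<in>?A. \<Sum>b\<in>?A - {a}. ?f a b)
      = (\<Sum>b\<in>?A - {i}. ?f i b) + (\<Sum>a\<in>?A - {i}. \<Sum>b\<in>?A - {a}. ?f a b)"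
    using i by (intro sum.remove) auto
  also have "(\<Sum>a\<in>?A - {i}. \<Sum>b\<in>?A - {a}. ?f a b)
      = (\<Sum>a\<in>?A - {i}. ?f a i + (\<Sum>b\<in>?A - {a} - {i}. ?f a b))"
    using i by (intro sum.cong refl sum.remove) auto
  also have "\<dots> = (\<Sum>a\<in>?A - {i}. ?f i a) + (\<Sum>a\<in>?A - {i}. \<Sum>b\<in>?A - {a} - {i}. ?f a b)"
    by (simp only: sum.distrib sym[of _ i])
  also have "(\<Sum>a\<in>?A - {i}. \<Sum>b\<in>?A - {a} - {i}. ?f a b)
      = (\<Sum>a\<in>?A - {i}. \<Sum>b\<in>?A - {a} - {i}. m a * m b * pair_potential \<kappa> (Q a) (Q b))"
    by (intro sum.cong refl) auto
  also have "(\<Sum>b\<in>?A - {i}. ?f i b) = (\<Sum>b\<in>?A - {i}. m i * m b * pair_potential \<kappa> x (Q b))"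
    by (intro sum.cong refl) auto
  finally show ?thesis by (simp only: ring_distribs)
qed

text \<open>The symmetric coefficient of the attraction between two bodies. The value 0 on the diagonal lets
all later sums run over the full square of indices, where they can be symmetrized by exchanging the
order of summation.\<close>

definition pull :: "real \<Rightarrow> (nat \<Rightarrow> real) \<Rightarrow> (nat \<Rightarrow> real^3) \<Rightarrow> nat \<Rightarrow> nat \<Rightarrow> real" where
  "pull \<kappa> m Q a b = (if a = b then 0
     else m a * m b * (\<kappa> * sqrt \<kappa> / sqrt (1 - (\<kappa> * (Q a \<bullet> Q b))\<^sup>2) ^ 3))"

lemma pull_commute: "pull \<kappa> m Q a b = pull \<kappa> m Q b a"
  by (simp add: pull_def inner_commute mult.commute)

lemma singular_configurationI:
  assumes "a \<in> {1..n}" "b \<in> {1..n}" "a \<noteq> b" "(\<kappa> * (Q a \<bullet> Q b))\<^sup>2 = 1"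
  shows "singular_configuration \<kappa> n Q"
proof (cases "a < b")
  case True
  then show ?thesis using assms unfolding singular_configuration_def by blast
next
  case False
  then have "b < a" "(\<kappa> * (Q b \<bullet> Q a))\<^sup>2 = 1" using assms by (simp_all add: inner_commute)
  then show ?thesis using assms unfolding singular_configuration_def by blast
qed

lemma grad_body_curved_potential:
  assumes "\<kappa> > 0" and i: "i \<in> {1..n}"
    and sphere: "\<And>a. a \<in> {1..n} \<Longrightarrow> \<kappa> * (Q a \<bullet> Q a) = 1"
    and nonsing: "\<not> singular_configuration \<kappa> n Q"
  shows "grad_body (curved_potential \<kappa> n m) i Q =
    (\<Sum>b\<in>{1..n}. pull \<kappa> m Q i b *\<^sub>R (Q b - (\<kappa> * (Q i \<bullet> Q b)) *\<^sub>R Q i))"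
proof -
  let ?D = "\<lambda>b. (\<kappa> * sqrt \<kappa> / sqrt (1 - (\<kappa> * (Q i \<bullet> Q b))\<^sup>2) ^ 3) *\<^sub>R (Q b - (\<kappa> * (Q i \<bullet> Q b)) *\<^sub>R Q i)"
  have "GDERIV (\<lambda>x. pair_potential \<kappa> x (Q b)) (Q i) :> ?D b" if "b \<in> {1..n} - {i}" for b
    using that assms singular_configurationI[of i n b \<kappa> Q]
    by (intro GDERIV_pair_potential) auto
  then have pair: "((\<lambda>x. pair_potential \<kappa> x (Q b)) has_derivative (\<lambda>h. h \<bullet> ?D b)) (at (Q i))"
    if "b \<in> {1..n} - {i}" for b
    using that by (simp add: gderiv_def)
  have "((\<lambda>x. curved_potential \<kappa> n m (Q(i := x))) has_derivative
      (\<lambda>h. 0 + (\<Sum>b\<in>{1..n} - {i}. m i * m b * (h \<bullet> ?D b)))) (at (Q i))"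
    unfolding curved_potential_fun_upd[OF i]
    by (intro has_derivative_add has_derivative_sum has_derivative_mult_right has_derivative_const pair)
  also have "(\<lambda>h. 0 + (\<Sum>b\<in>{1..n} - {i}. m i * m b * (h \<bullet> ?D b)))
      = (\<lambda>h. h \<bullet> (\<Sum>b\<in>{1..n} - {i}. (m i * m b) *\<^sub>R ?D b))"
    by (simp add: inner_sum_right mult.assoc)
  finally have "grad_body (curved_potential \<kappa> n m) i Q = (\<Sum>b\<in>{1..n} - {i}. (m i * m b) *\<^sub>R ?D b)"
    unfolding grad_body_def by (intro gradient_eqI) (simp only: gderiv_def)
  also have "\<dots> = (\<Sum>b\<in>{1..n} - {i}. pull \<kappa> m Q i b *\<^sub>R (Q b - (\<kappa> * (Q i \<bullet> Q b)) *\<^sub>R Q i))"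
    by (intro sum.cong refl) (auto simp: pull_def)
  also have "\<dots> = (\<Sum>b\<in>{1..n}. pull \<kappa> m Q i b *\<^sub>R (Q b - (\<kappa> * (Q i \<bullet> Q b)) *\<^sub>R Q i))"
    by (intro sum.mono_neutral_left) (auto simp: pull_def)
  finally show ?thesis .
qed

section \<open>Energy and the moment about the pole\<close>

lemma sum_antisymmetric_eq_0:
  fixes f :: "'i \<Rightarrow> 'i \<Rightarrow> 'a::real_vector"
  assumes "\<And>a b. a \<in> A \<Longrightarrow> b \<in> A \<Longrightarrow> f b a = - f a b"
  shows "(\<Sum>a\<in>A. \<Sum>b\<in>A. f a b) = 0"
proof -
  have "(\<Sum>a\<in>A. \<Sum>b\<in>A. f a b) = (\<Sum>b\<in>A. \<Sum>a\<in>A. - f b a)"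
    by (subst sum.swap) (intro sum.cong refl assms)
  also have "\<dots> = - (\<Sum>a\<in>A. \<Sum>b\<in>A. f a b)"
    by (simp add: sum_negf)
  finally have "(2::real) *\<^sub>R (\<Sum>a\<in>A. \<Sum>b\<in>A. f a b) = 0"
    by (simp only: scaleR_2 eq_neg_iff_add_eq_0)
  then show ?thesis by simp
qed

lemma double_sum_symmetrize:
  fixes w :: "'i \<Rightarrow> 'i \<Rightarrow> real"
  assumes "\<And>a b. w a b = w b a"
  shows "(\<Sum>a\<in>A. \<Sum>b\<in>A. w a b * X a b) = (1/2) * (\<Sum>a\<in>A. \<Sum>b\<in>A. w a b * (X a b + X b a))"
proof -
  have "(\<Sum>a\<in>A. \<Sum>b\<in>A. w a b * X b a) = (\<Sum>a\<in>A. \<Sum>b\<in>A. w b a * X b a)"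
    by (intro sum.cong refl arg_cong2[where f = times] assms)
  also have "\<dots> = (\<Sum>a\<in>A. \<Sum>b\<in>A. w a b * X a b)" by (rule sum.swap)
  finally show ?thesis by (simp add: distrib_left sum.distrib)
qed

lemma bounded_bilinear_cross3: "bounded_bilinear cross3"
  using bilinear_cross by (simp add: bilinear_conv_bounded_bilinear)

lemma cross3_component_3: "cross3 x y $ 3 = x $ 1 * y $ 2 - x $ 2 * y $ 1"
  by (simp add: cross_components)

definition kinetic_energy :: "nat \<Rightarrow> (nat \<Rightarrow> real) \<Rightarrow> (nat \<Rightarrow> real^3) \<Rightarrow> real" where
  "kinetic_energy n m P = (\<Sum>a\<in>{1..n}. (P a \<bullet> P a) / (2 * m a))"

text \<open>On the sphere the potential of a pair is \<open>\<surd>\<kappa>\<close> times the product of the masses and the cotangent of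
the angle between them. As this form involves only the inner product of the two positions, it can
be differentiated along a motion by a one-variable rule.\<close>

definition cot_potential :: "real \<Rightarrow> (nat \<Rightarrow> real) \<Rightarrow> (nat \<Rightarrow> real^3) \<Rightarrow> nat \<Rightarrow> nat \<Rightarrow> real" where
  "cot_potential \<kappa> m Q a b = (if a = b then 0
     else m a * m b * (sqrt \<kappa> * (\<kappa> * (Q a \<bullet> Q b) / sqrt (1 - (\<kappa> * (Q a \<bullet> Q b))\<^sup>2))))"

definition energy :: "real \<Rightarrow> nat \<Rightarrow> (nat \<Rightarrow> real) \<Rightarrow> (nat \<Rightarrow> real^3) \<Rightarrow> (nat \<Rightarrow> real^3) \<Rightarrow> real" where
  "energy \<kappa> n m Q P =
     kinetic_energy n m P - (1/2) * (\<Sum>a\<in>{1..n}. \<Sum>b\<in>{1..n}. cot_potential \<kappa> m Q a b)"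

text \<open>The depth below the pole, and not the squared distance from the polar axis, since its second
derivative is the vertical component of the equations of motion itself. The factor
\<open>1 / sqrt \<kappa>\<close> makes a summand agree with half the mass times the squared distance to leading order
at the pole.\<close>

definition polar_moment :: "real \<Rightarrow> nat \<Rightarrow> (nat \<Rightarrow> real) \<Rightarrow> (nat \<Rightarrow> real^3) \<Rightarrow> real" where
  "polar_moment \<kappa> n m Q = (\<Sum>a\<in>{1..n}. m a * ((1 / sqrt \<kappa> - Q a $ 3) / sqrt \<kappa>))"

lemma cot_of_cos_has_real_derivative:
  assumes f: "(f has_real_derivative f') (at t within S)" and lt: "(f t)\<^sup>2 < 1"
  shows "((\<lambda>t. f t / sqrt (1 - (f t)\<^sup>2)) has_real_derivative f' / sqrt (1 - (f t)\<^sup>2) ^ 3)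
    (at t within S)"
proof -
  define s where "s = sqrt (1 - (f t)\<^sup>2)"
  have s: "s > 0" "s\<^sup>2 + (f t)\<^sup>2 = 1" using lt by (auto simp: s_def)
  have root: "((\<lambda>t. sqrt (1 - (f t)\<^sup>2)) has_real_derivative - (f t * f' / s)) (at t within S)"
    using f lt unfolding s_def by (auto intro!: derivative_eq_intros simp: field_simps)
  have nz: "sqrt (1 - (f t)\<^sup>2) \<noteq> 0" using lt by simp
  have "(f' * s - f t * - (f t * f' / s)) / (s * s) = f' * (s\<^sup>2 + (f t)\<^sup>2) / s ^ 3"
    using s(1) by (simp add: divide_simps power2_eq_square power3_eq_cube) (simp add: algebra_simps)
  also have "\<dots> = f' / s ^ 3" by (simp add: s(2))
  finally show ?thesis
    using DERIV_divide[OF f root nz] by (simp add: s_def)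
qed

section \<open>Conservation laws\<close>

locale curved_motion =
  fixes \<kappa> :: real and n :: nat and m :: "nat \<Rightarrow> real" and J :: "real set"
    and q p :: "real \<Rightarrow> nat \<Rightarrow> real^3"
  assumes curvature_pos: "\<kappa> > 0"
    and mass_pos: "\<And>a. a \<in> {1..n} \<Longrightarrow> m a > 0"
    and solution: "curved_nbody_solution \<kappa> n m J q p"
begin

lemma on_sphere: "t \<in> J \<Longrightarrow> a \<in> {1..n} \<Longrightarrow> \<kappa> * (q t a \<bullet> q t a) = 1"
  and tangent: "t \<in> J \<Longrightarrow> a \<in> {1..n} \<Longrightarrow> q t a \<bullet> p t a = 0"
  and nonsingular: "t \<in> J \<Longrightarrow> \<not> singular_configuration \<kappa> n (q t)"
  and velocity: "t \<in> J \<Longrightarrow> a \<in> {1..n} \<Longrightarrow>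
    ((\<lambda>s. q s a) has_vector_derivative (1 / m a) *\<^sub>R p t a) (at t within J)"
  using solution unfolding curved_nbody_solution_def by blast+

definition force :: "real \<Rightarrow> nat \<Rightarrow> real^3" where
  "force t a = (\<Sum>b\<in>{1..n}. pull \<kappa> m (q t) a b *\<^sub>R (q t b - (\<kappa> * (q t a \<bullet> q t b)) *\<^sub>R q t a))"

lemma newton:
  assumes "t \<in> J" "a \<in> {1..n}"
  shows "((\<lambda>s. p s a) has_vector_derivative
    force t a - ((1 / m a) * \<kappa> * (p t a \<bullet> p t a)) *\<^sub>R q t a) (at t within J)"
proof -
  have "grad_body (curved_potential \<kappa> n m) a (q t) = force t a"
    unfolding force_def
    using grad_body_curved_potential[OF curvature_pos assms(2) on_sphere[OF assms(1)] nonsingular[OF assms(1)]] .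
  moreover have "((\<lambda>s. p s a) has_vector_derivative
      grad_body (curved_potential \<kappa> n m) a (q t)
        - ((1 / m a) * \<kappa> * (p t a \<bullet> p t a)) *\<^sub>R q t a) (at t within J)"
    using solution assms unfolding curved_nbody_solution_def by blast
  ultimately show ?thesis by (simp only:)
qed

lemma cos_angle_square_less_1:
  assumes "t \<in> J" "a \<in> {1..n}" "b \<in> {1..n}" "a \<noteq> b"
  shows "(\<kappa> * (q t a \<bullet> q t b))\<^sup>2 < 1"
  using cos_angle_square_le_1[OF on_sphere on_sphere, OF assms(1,2,1,3)]
    singular_configurationI[OF assms(2-4)] nonsingular[OF assms(1)]
  by (auto simp: order_le_less)

text \<open>The radial parts of the forces and the momentum's cross product with the velocity vanish. Of the
attractions there remains a double sum of antisymmetric terms: action equals reaction.\<close>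

lemma angular_momentum_deriv:
  assumes t: "t \<in> J"
  shows "((\<lambda>s. angular_momentum n (q s) (p s)) has_vector_derivative 0) (at t within J)"
proof -
  interpret cross: bounded_bilinear cross3 by (rule bounded_bilinear_cross3)
  let ?p' = "\<lambda>a. force t a - ((1 / m a) * \<kappa> * (p t a \<bullet> p t a)) *\<^sub>R q t a"
  have "((\<lambda>s. angular_momentum n (q s) (p s)) has_vector_derivative
      (\<Sum>a\<in>{1..n}. cross3 (q t a) (?p' a) + cross3 ((1 / m a) *\<^sub>R p t a) (p t a))) (at t within J)"
    unfolding angular_momentum_def
    by (intro has_vector_derivative_sum cross.has_vector_derivative velocity newton t)
  also have "(\<Sum>a\<in>{1..n}. cross3 (q t a) (?p' a) + cross3 ((1 / m a) *\<^sub>R p t a) (p t a))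
      = (\<Sum>a\<in>{1..n}. \<Sum>b\<in>{1..n}. pull \<kappa> m (q t) a b *\<^sub>R cross3 (q t a) (q t b))"
    by (simp add: force_def cross.diff_right cross.sum_right cross.scaleR_right cross.scaleR_left)
  also have "\<dots> = 0"
  proof (rule sum_antisymmetric_eq_0)
    fix a b
    show "pull \<kappa> m (q t) b a *\<^sub>R cross3 (q t b) (q t a) = - (pull \<kappa> m (q t) a b *\<^sub>R cross3 (q t a) (q t b))"
      by (subst cross_skew, subst pull_commute) simp
  qed
  finally show ?thesis .
qed

lemma cot_potential_deriv:
  assumes "t \<in> J" "a \<in> {1..n}" "b \<in> {1..n}"
  shows "((\<lambda>s. cot_potential \<kappa> m (q s) a b) has_real_derivative
    pull \<kappa> m (q t) a b * ((p t a \<bullet> q t b) / m a + (p t b \<bullet> q t a) / m b)) (at t within J)"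
proof (cases "a = b")
  case False
  have "((\<lambda>s. q s a \<bullet> q s b) has_vector_derivative
      q t a \<bullet> (1 / m b) *\<^sub>R p t b + (1 / m a) *\<^sub>R p t a \<bullet> q t b) (at t within J)"
    by (intro bounded_bilinear.has_vector_derivative[OF bounded_bilinear_inner] velocity assms)
  then have "((\<lambda>s. \<kappa> * (q s a \<bullet> q s b)) has_real_derivative
      \<kappa> * ((p t a \<bullet> q t b) / m a + (p t b \<bullet> q t a) / m b)) (at t within J)"
    unfolding has_real_derivative_iff_has_vector_derivative[symmetric]
    by (intro DERIV_cmult) (simp add: inner_commute add.commute)
  from cot_of_cos_has_real_derivative[OF this cos_angle_square_less_1[OF assms False]]
  have "((\<lambda>s. m a * m b * (sqrt \<kappa> * (\<kappa> * (q s a \<bullet> q s b) / sqrt (1 - (\<kappa> * (q s a \<bullet> q s b))\<^sup>2))))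
      has_real_derivative m a * m b * (sqrt \<kappa> * (\<kappa> * ((p t a \<bullet> q t b) / m a + (p t b \<bullet> q t a) / m b)
        / sqrt (1 - (\<kappa> * (q t a \<bullet> q t b))\<^sup>2) ^ 3))) (at t within J)"
    by (intro DERIV_cmult)
  then show ?thesis
    using False by (simp add: cot_potential_def pull_def mult_ac)
qed (simp add: cot_potential_def pull_def)

text \<open>The radial terms of the equations of motion do no work, the momenta being tangent to the sphere.\<close>

lemma kinetic_energy_deriv:
  assumes t: "t \<in> J"
  shows "((\<lambda>s. kinetic_energy n m (p s)) has_real_derivative
    (\<Sum>a\<in>{1..n}. \<Sum>b\<in>{1..n}. pull \<kappa> m (q t) a b * ((p t a \<bullet> q t b) / m a))) (at t within J)"
proof -
  have "((\<lambda>s. (p s a \<bullet> p s a) / (2 * m a)) has_real_derivative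
      (\<Sum>b\<in>{1..n}. pull \<kappa> m (q t) a b * ((p t a \<bullet> q t b) / m a))) (at t within J)"
    if a: "a \<in> {1..n}" for a
  proof -
    let ?p' = "force t a - ((1 / m a) * \<kappa> * (p t a \<bullet> p t a)) *\<^sub>R q t a"
    have "((\<lambda>s. p s a \<bullet> p s a) has_vector_derivative p t a \<bullet> ?p' + ?p' \<bullet> p t a) (at t within J)"
      by (intro bounded_bilinear.has_vector_derivative[OF bounded_bilinear_inner] newton t a)
    then have "((\<lambda>s. (p s a \<bullet> p s a) / (2 * m a)) has_real_derivative
        (p t a \<bullet> ?p' + ?p' \<bullet> p t a) / (2 * m a)) (at t within J)"
      unfolding has_real_derivative_iff_has_vector_derivative[symmetric] by (rule DERIV_cdivide)
    also have "p t a \<bullet> ?p' + ?p' \<bullet> p t a = 2 * (p t a \<bullet> force t a)"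
      using tangent[OF t a] by (simp add: inner_commute inner_diff_right)
    also have "2 * (p t a \<bullet> force t a) / (2 * m a) = (p t a \<bullet> force t a) / m a" by simp
    also have "p t a \<bullet> force t a = (\<Sum>b\<in>{1..n}. pull \<kappa> m (q t) a b * (p t a \<bullet> q t b))"
      using tangent[OF t a] by (simp add: force_def inner_sum_right inner_diff_right inner_commute)
    finally show ?thesis by (simp add: sum_divide_distrib)
  qed
  then show ?thesis unfolding kinetic_energy_def by (intro DERIV_sum)
qed

lemma energy_deriv:
  assumes t: "t \<in> J"
  shows "((\<lambda>s. energy \<kappa> n m (q s) (p s)) has_real_derivative 0) (at t within J)"
proof -
  have "((\<lambda>s. energy \<kappa> n m (q s) (p s)) has_real_derivative
      (\<Sum>a\<in>{1..n}. \<Sum>b\<in>{1..n}. pull \<kappa> m (q t) a b * ((p t a \<bullet> q t b) / m a))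
      - (1/2) * (\<Sum>a\<in>{1..n}. \<Sum>b\<in>{1..n}. pull \<kappa> m (q t) a b *
          ((p t a \<bullet> q t b) / m a + (p t b \<bullet> q t a) / m b))) (at t within J)"
    unfolding energy_def
    by (intro DERIV_diff kinetic_energy_deriv DERIV_cmult DERIV_sum cot_potential_deriv t)
  then show ?thesis
    by (subst (asm) double_sum_symmetrize[OF pull_commute]) simp
qed

section \<open>The Lagrange-Jacobi inequality near the pole\<close>

lemma polar_moment_deriv:
  assumes t: "t \<in> J"
  shows "((\<lambda>s. polar_moment \<kappa> n m (q s)) has_real_derivative
    - (\<Sum>a\<in>{1..n}. p t a $ 3) / sqrt \<kappa>) (at t within J)"
proof -
  have "((\<lambda>s. m a * ((1 / sqrt \<kappa> - q s a $ 3) / sqrt \<kappa>)) has_real_derivative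
      - (p t a $ 3) / sqrt \<kappa>) (at t within J)" if a: "a \<in> {1..n}" for a
  proof -
    have "((\<lambda>s. q s a $ 3) has_real_derivative ((1 / m a) *\<^sub>R p t a) $ 3) (at t within J)"
      unfolding has_real_derivative_iff_has_vector_derivative
      by (intro bounded_linear.has_vector_derivative[OF bounded_linear_vec_nth] velocity t a)
    then have "((\<lambda>s. m a * ((1 / sqrt \<kappa> - q s a $ 3) / sqrt \<kappa>)) has_real_derivative
        m a * ((0 - ((1 / m a) *\<^sub>R p t a) $ 3) / sqrt \<kappa>)) (at t within J)"
      by (intro DERIV_cmult DERIV_cdivide DERIV_diff DERIV_const)
    then show ?thesis using mass_pos[OF a] by simp
  qed
  then have "((\<lambda>s. polar_moment \<kappa> n m (q s)) has_real_derivative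
      (\<Sum>a\<in>{1..n}. - (p t a $ 3) / sqrt \<kappa>)) (at t within J)"
    unfolding polar_moment_def by (intro DERIV_sum)
  then show ?thesis by (simp add: sum_negf sum_divide_distrib)
qed

text \<open>The first sum is the centripetal reaction of the sphere, which pushes moving bodies down from the
pole. In the second, the symmetrized vertical attractions of a pair combine to a multiple of
\<open>1 - cos\<close> of the angle between them: two bodies of equal height pull each other upwards, since the
geodesic between them bulges towards the pole.\<close>

definition polar_acceleration :: "real \<Rightarrow> real" where
  "polar_acceleration t = sqrt \<kappa> * (\<Sum>a\<in>{1..n}. (p t a \<bullet> p t a) / m a * q t a $ 3)
     - (1/2) * (\<Sum>a\<in>{1..n}. \<Sum>b\<in>{1..n}. pull \<kappa> m (q t) a b *
         ((1 - \<kappa> * (q t a \<bullet> q t b)) * (q t a $ 3 + q t b $ 3))) / sqrt \<kappa>"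

lemma polar_moment_deriv2:
  assumes t: "t \<in> J"
  shows "((\<lambda>s. - (\<Sum>a\<in>{1..n}. p s a $ 3) / sqrt \<kappa>) has_real_derivative polar_acceleration t)
    (at t within J)"
proof -
  let ?X = "\<lambda>a b. q t b $ 3 - \<kappa> * (q t a \<bullet> q t b) * q t a $ 3"
  let ?w = "pull \<kappa> m (q t)"
  have "((\<lambda>s. p s a $ 3) has_real_derivative
      (force t a - ((1 / m a) * \<kappa> * (p t a \<bullet> p t a)) *\<^sub>R q t a) $ 3) (at t within J)"
    if a: "a \<in> {1..n}" for a
    unfolding has_real_derivative_iff_has_vector_derivative
    by (intro bounded_linear.has_vector_derivative[OF bounded_linear_vec_nth] newton t a)
  then have "((\<lambda>s. - (\<Sum>a\<in>{1..n}. p s a $ 3) / sqrt \<kappa>) has_real_derivative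
      - (\<Sum>a\<in>{1..n}. (force t a - ((1 / m a) * \<kappa> * (p t a \<bullet> p t a)) *\<^sub>R q t a) $ 3) / sqrt \<kappa>)
      (at t within J)"
    by (intro DERIV_cdivide DERIV_minus DERIV_sum)
  also have "(\<Sum>a\<in>{1..n}. (force t a - ((1 / m a) * \<kappa> * (p t a \<bullet> p t a)) *\<^sub>R q t a) $ 3)
      = (\<Sum>a\<in>{1..n}. \<Sum>b\<in>{1..n}. ?w a b * ?X a b) - \<kappa> * (\<Sum>a\<in>{1..n}. (p t a \<bullet> p t a) / m a * q t a $ 3)"
    by (simp add: force_def sum_subtractf sum_distrib_left mult_ac)
  also have "(\<Sum>a\<in>{1..n}. \<Sum>b\<in>{1..n}. ?w a b * ?X a b)
      = (1/2) * (\<Sum>a\<in>{1..n}. \<Sum>b\<in>{1..n}. ?w a b * (?X a b + ?X b a))"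
    by (rule double_sum_symmetrize[OF pull_commute])
  also have "(\<Sum>a\<in>{1..n}. \<Sum>b\<in>{1..n}. ?w a b * (?X a b + ?X b a))
      = (\<Sum>a\<in>{1..n}. \<Sum>b\<in>{1..n}. ?w a b * ((1 - \<kappa> * (q t a \<bullet> q t b)) * (q t a $ 3 + q t b $ 3)))"
    by (intro sum.cong refl) (simp add: inner_commute algebra_simps)
  finally have "((\<lambda>s. - (\<Sum>a\<in>{1..n}. p s a $ 3) / sqrt \<kappa>) has_real_derivative
      - ((1/2) * (\<Sum>a\<in>{1..n}. \<Sum>b\<in>{1..n}. ?w a b *
          ((1 - \<kappa> * (q t a \<bullet> q t b)) * (q t a $ 3 + q t b $ 3)))
        - \<kappa> * (\<Sum>a\<in>{1..n}. (p t a \<bullet> p t a) / m a * q t a $ 3)) / sqrt \<kappa>) (at t within J)" .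
  moreover have "- ((1/2) * S - \<kappa> * K) / sqrt \<kappa> = sqrt \<kappa> * K - (1/2) * S / sqrt \<kappa>" for S K
  proof -
    have "- ((1/2) * S - \<kappa> * K) / sqrt \<kappa> = \<kappa> / sqrt \<kappa> * K - (1/2) * S / sqrt \<kappa>"
      by (simp add: diff_divide_distrib)
    also have "\<kappa> / sqrt \<kappa> = sqrt \<kappa>" using curvature_pos by (simp add: real_div_sqrt)
    finally show ?thesis .
  qed
  ultimately show ?thesis by (simp only: polar_acceleration_def)
qed

lemma height_le:
  assumes "t \<in> J" "a \<in> {1..n}"
  shows "sqrt \<kappa> * q t a $ 3 \<le> 1"
proof -
  have "(q t a $ 3)\<^sup>2 \<le> q t a \<bullet> q t a"
    by (simp add: inner_vec_def sum_3 power2_eq_square)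
  then have "\<kappa> * (q t a $ 3)\<^sup>2 \<le> \<kappa> * (q t a \<bullet> q t a)"
    using curvature_pos by (intro mult_left_mono) auto
  then have "(sqrt \<kappa> * q t a $ 3)\<^sup>2 \<le> 1"
    using on_sphere[OF assms] curvature_pos by (simp add: power_mult_distrib)
  then show ?thesis by (simp add: abs_square_le_1 abs_le_iff)
qed

text \<open>Up to the common factor \<open>m\<^sub>a m\<^sub>b \<surd>\<kappa> / s\<^sup>3\<close> the claim compares \<open>(1 - c) z\<close>, where \<open>z \<le> 2\<close> is the rescaled
sum of heights, with \<open>(5/4) c s\<^sup>2 = (5/4) c (1 - c) (1 + c)\<close>. At the pole the ratio of the two sides
without the factor \<open>5/4\<close> is 1; the factor leaves room for \<open>c\<close> down to \<open>9/10\<close>.\<close>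

lemma pull_le_cot_potential:
  assumes t: "t \<in> J" and a: "a \<in> {1..n}" and b: "b \<in> {1..n}"
    and close: "\<kappa> * (q t a \<bullet> q t b) \<ge> 9/10"
  shows "pull \<kappa> m (q t) a b * ((1 - \<kappa> * (q t a \<bullet> q t b)) * (q t a $ 3 + q t b $ 3)) / sqrt \<kappa>
    \<le> (5/4) * cot_potential \<kappa> m (q t) a b"
proof (cases "a = b")
  case False
  define c where "c = \<kappa> * (q t a \<bullet> q t b)"
  define s where "s = sqrt (1 - c\<^sup>2)"
  define z where "z = sqrt \<kappa> * (q t a $ 3 + q t b $ 3)"
  define M where "M = m a * m b * sqrt \<kappa> / s ^ 3"
  have c: "c\<^sup>2 < 1" "c \<ge> 9/10"
    using cos_angle_square_less_1[OF t a b False] close by (simp_all add: c_def)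
  have c1: "c < 1" using c by (simp add: abs_square_less_1 abs_less_iff)
  have s: "s > 0" "s\<^sup>2 = (1 - c) * (1 + c)"
    using c by (auto simp: s_def algebra_simps power2_eq_square)
  have M: "M > 0" using mass_pos[OF a] mass_pos[OF b] curvature_pos s by (simp add: M_def)
  have "2 \<le> (5/4) * (c * (1 + c))"
    using mult_mono[of "9/10" c "19/10" "1 + c"] c by simp
  moreover have "z \<le> 2"
    using height_le[OF t a] height_le[OF t b] by (simp add: z_def distrib_left)
  ultimately have "(1 - c) * z \<le> (1 - c) * ((5/4) * (c * (1 + c)))"
    using c1 by (intro mult_left_mono) auto
  also have "\<dots> = (5/4) * (c * s\<^sup>2)" by (simp add: s(2))
  finally have "M * ((1 - c) * z) \<le> M * ((5/4) * (c * s\<^sup>2))"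
    using M by (intro mult_left_mono) auto
  moreover have "pull \<kappa> m (q t) a b * ((1 - c) * (q t a $ 3 + q t b $ 3)) / sqrt \<kappa> = M * ((1 - c) * z)"
    using False curvature_pos
    by (simp add: pull_def c_def[symmetric] s_def[symmetric] M_def z_def)
  moreover have "(5/4) * cot_potential \<kappa> m (q t) a b = M * ((5/4) * (c * s\<^sup>2))"
  proof -
    have "M * s\<^sup>2 = m a * m b * sqrt \<kappa> / s"
      using s(1) by (simp add: M_def power2_eq_square power3_eq_cube)
    moreover have "cot_potential \<kappa> m (q t) a b = m a * m b * sqrt \<kappa> / s * c"
      using False by (simp add: cot_potential_def c_def[symmetric] s_def[symmetric])
    ultimately have "cot_potential \<kappa> m (q t) a b = M * s\<^sup>2 * c" by (simp only:)
    then show ?thesis by (simp add: mult_ac)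
  qed
  ultimately show ?thesis by (simp add: c_def)
qed (simp add: pull_def cot_potential_def)

text \<open>The bounds give \<open>(7/4) K - (5/4) V\<close>, and \<open>V\<close> is \<open>K\<close> minus the energy. What the two constants
have to ensure is that a positive multiple of \<open>K\<close> survives.\<close>

lemma polar_acceleration_ge:
  assumes t: "t \<in> J"
    and high: "\<And>a. a \<in> {1..n} \<Longrightarrow> sqrt \<kappa> * q t a $ 3 \<ge> 7/8"
    and close: "\<And>a b. a \<in> {1..n} \<Longrightarrow> b \<in> {1..n} \<Longrightarrow> \<kappa> * (q t a \<bullet> q t b) \<ge> 9/10"
  shows "polar_acceleration t \<ge>
    (1/2) * kinetic_energy n m (p t) + (5/4) * energy \<kappa> n m (q t) (p t)"
proof -
  define V where "V = (1/2) * (\<Sum>a\<in>{1..n}. \<Sum>b\<in>{1..n}. cot_potential \<kappa> m (q t) a b)"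
  let ?W = "\<lambda>a b. pull \<kappa> m (q t) a b * ((1 - \<kappa> * (q t a \<bullet> q t b)) * (q t a $ 3 + q t b $ 3))"
  have "(7/4) * kinetic_energy n m (p t) = (\<Sum>a\<in>{1..n}. (p t a \<bullet> p t a) / m a * (7/8))"
    by (simp add: kinetic_energy_def sum_distrib_left mult_ac)
  also have "\<dots> \<le> (\<Sum>a\<in>{1..n}. (p t a \<bullet> p t a) / m a * (sqrt \<kappa> * q t a $ 3))"
    using high mass_pos by (intro sum_mono mult_left_mono) (auto intro: divide_nonneg_pos)
  also have "\<dots> = sqrt \<kappa> * (\<Sum>a\<in>{1..n}. (p t a \<bullet> p t a) / m a * q t a $ 3)"
    by (simp add: sum_distrib_left mult_ac)
  finally have kin: "(7/4) * kinetic_energy n m (p t)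
      \<le> sqrt \<kappa> * (\<Sum>a\<in>{1..n}. (p t a \<bullet> p t a) / m a * q t a $ 3)" .
  have "(\<Sum>a\<in>{1..n}. \<Sum>b\<in>{1..n}. ?W a b) / sqrt \<kappa> = (\<Sum>a\<in>{1..n}. \<Sum>b\<in>{1..n}. ?W a b / sqrt \<kappa>)"
    by (simp only: sum_divide_distrib)
  also have "\<dots> \<le> (\<Sum>a\<in>{1..n}. \<Sum>b\<in>{1..n}. (5/4) * cot_potential \<kappa> m (q t) a b)"
    by (intro sum_mono pull_le_cot_potential t close)
  also have "\<dots> = (5/2) * V" by (simp add: V_def sum_distrib_left)
  finally have "(1/2) * (\<Sum>a\<in>{1..n}. \<Sum>b\<in>{1..n}. ?W a b) / sqrt \<kappa> \<le> (5/4) * V"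
    by (simp add: mult.commute)
  then have "polar_acceleration t \<ge> (7/4) * kinetic_energy n m (p t) - (5/4) * V"
    using kin by (simp only: polar_acceleration_def)
  then show ?thesis by (simp add: energy_def V_def algebra_simps)
qed

section \<open>The angular momentum about the polar axis\<close>

lemma polar_moment_nonneg:
  assumes "t \<in> J"
  shows "polar_moment \<kappa> n m (q t) \<ge> 0"
  unfolding polar_moment_def
proof (rule sum_nonneg)
  fix a assume a: "a \<in> {1..n}"
  have "q t a $ 3 \<le> 1 / sqrt \<kappa>"
    using height_le[OF assms a] curvature_pos by (simp add: field_simps)
  then show "0 \<le> m a * ((1 / sqrt \<kappa> - q t a $ 3) / sqrt \<kappa>)"
    using mass_pos[OF a] curvature_pos by (intro mult_nonneg_nonneg divide_nonneg_pos) auto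
qed

text \<open>The Cauchy-Schwarz inequality, first for the two horizontal components of one body and then for the
sum over the bodies, bounds the square by the moment of inertia about the polar axis times \<open>2 K\<close>.
On the sphere of radius \<open>h = 1/\<surd>\<kappa>\<close>, the squared distance of a body from the axis is
\<open>h\<^sup>2 - z\<^sup>2 = (h - z) (h + z) \<le> 2 h (h - z)\<close>, which turns the moment of inertia into twice the polar
moment.\<close>

lemma angular_momentum_square_le:
  assumes t: "t \<in> J"
  shows "(angular_momentum n (q t) (p t) $ 3)\<^sup>2
    \<le> 4 * polar_moment \<kappa> n m (q t) * kinetic_energy n m (p t)"
proof -
  let ?r = "\<lambda>a. m a * ((q t a $ 1)\<^sup>2 + (q t a $ 2)\<^sup>2)"
  let ?k = "\<lambda>a. (p t a \<bullet> p t a) / m a"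
  have r_nonneg: "?r a \<ge> 0" and k_nonneg: "?k a \<ge> 0" if "a \<in> {1..n}" for a
    using mass_pos[OF that] by auto
  have term_le: "\<bar>cross3 (q t a) (p t a) $ 3\<bar> \<le> sqrt (?r a) * sqrt (?k a)" if a: "a \<in> {1..n}" for a
  proof -
    have lagrange: "(x1 * y2 - x2 * y1)\<^sup>2 \<le> (x1\<^sup>2 + x2\<^sup>2) * (y1\<^sup>2 + y2\<^sup>2)" for x1 x2 y1 y2 :: real
    proof -
      have "(x1\<^sup>2 + x2\<^sup>2) * (y1\<^sup>2 + y2\<^sup>2) = (x1 * y2 - x2 * y1)\<^sup>2 + (x1 * y1 + x2 * y2)\<^sup>2"
        by algebra
      then show ?thesis by simp
    qed
    have "(cross3 (q t a) (p t a) $ 3)\<^sup>2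
        \<le> ((q t a $ 1)\<^sup>2 + (q t a $ 2)\<^sup>2) * ((p t a $ 1)\<^sup>2 + (p t a $ 2)\<^sup>2)"
      unfolding cross3_component_3 by (rule lagrange)
    also have "\<dots> \<le> ((q t a $ 1)\<^sup>2 + (q t a $ 2)\<^sup>2) * (p t a \<bullet> p t a)"
      by (intro mult_left_mono) (auto simp: inner_vec_def sum_3 power2_eq_square)
    also have "\<dots> = ?r a * ?k a" using mass_pos[OF a] by simp
    finally have "sqrt ((cross3 (q t a) (p t a) $ 3)\<^sup>2) \<le> sqrt (?r a * ?k a)"
      by (rule real_sqrt_le_mono)
    then show ?thesis by (simp only: real_sqrt_mult real_sqrt_abs)
  qed
  have "\<bar>angular_momentum n (q t) (p t) $ 3\<bar> \<le> (\<Sum>a\<in>{1..n}. \<bar>cross3 (q t a) (p t a) $ 3\<bar>)"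
    unfolding angular_momentum_def by simp
  also have "\<dots> \<le> (\<Sum>a\<in>{1..n}. sqrt (?r a) * sqrt (?k a))"
    by (intro sum_mono term_le)
  finally have "\<bar>angular_momentum n (q t) (p t) $ 3\<bar>\<^sup>2
      \<le> (\<Sum>a\<in>{1..n}. sqrt (?r a) * sqrt (?k a))\<^sup>2"
    by (intro power_mono) auto
  then have "(angular_momentum n (q t) (p t) $ 3)\<^sup>2
      \<le> (\<Sum>a\<in>{1..n}. sqrt (?r a) * sqrt (?k a))\<^sup>2"
    by (simp only: power2_abs)
  also have "\<dots> \<le> (\<Sum>a\<in>{1..n}. (sqrt (?r a))\<^sup>2) * (\<Sum>a\<in>{1..n}. (sqrt (?k a))\<^sup>2)"
    by (rule Cauchy_Schwarz_ineq_sum)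
  also have "\<dots> = (\<Sum>a\<in>{1..n}. ?r a) * (\<Sum>a\<in>{1..n}. ?k a)"
    using r_nonneg k_nonneg by (intro arg_cong2[where f = times] sum.cong refl) auto
  also have "(\<Sum>a\<in>{1..n}. ?k a) = 2 * kinetic_energy n m (p t)"
    by (simp add: kinetic_energy_def sum_distrib_left)
  also have "(\<Sum>a\<in>{1..n}. ?r a) * (2 * kinetic_energy n m (p t))
      \<le> (2 * polar_moment \<kappa> n m (q t)) * (2 * kinetic_energy n m (p t))"
  proof (rule mult_right_mono)
    have "?r a \<le> 2 * (m a * ((1 / sqrt \<kappa> - q t a $ 3) / sqrt \<kappa>))" if a: "a \<in> {1..n}" for a
    proof -
      define h where "h = 1 / sqrt \<kappa>"
      have h: "h > 0" "h\<^sup>2 = 1 / \<kappa>" using curvature_pos by (simp_all add: h_def power_divide)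
      have z: "q t a $ 3 \<le> h"
        using height_le[OF t a] curvature_pos by (simp add: h_def field_simps)
      have "q t a \<bullet> q t a = h\<^sup>2"
        using on_sphere[OF t a] curvature_pos by (simp add: h field_simps)
      then have "(q t a $ 1)\<^sup>2 + (q t a $ 2)\<^sup>2 = (h - q t a $ 3) * (h + q t a $ 3)"
        by (simp add: inner_vec_def sum_3 power2_eq_square algebra_simps)
      also have "\<dots> \<le> (h - q t a $ 3) * (2 * h)"
        using z by (intro mult_left_mono) auto
      finally have "?r a \<le> m a * ((h - q t a $ 3) * (2 * h))"
        using mass_pos[OF a] by (intro mult_left_mono) auto
      then show ?thesis by (simp add: h_def mult_ac)
    qed
    then show "(\<Sum>a\<in>{1..n}. ?r a) \<le> 2 * polar_moment \<kappa> n m (q t)"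
      unfolding polar_moment_def sum_distrib_left by (intro sum_mono)
    show "0 \<le> 2 * kinetic_energy n m (p t)"
      unfolding kinetic_energy_def using mass_pos
      by (intro mult_nonneg_nonneg sum_nonneg divide_nonneg_pos) auto
  qed
  finally show ?thesis by (simp add: mult_ac)
qed

section \<open>Total collision at the pole\<close>

lemma angular_momentum_constant:
  assumes "is_interval J"
  obtains c where "\<And>t. t \<in> J \<Longrightarrow> angular_momentum n (q t) (p t) = c"
proof -
  have "((\<lambda>t. angular_momentum n (q t) (p t)) has_derivative (\<lambda>h. 0)) (at t within J)"
    if "t \<in> J" for t
    using angular_momentum_deriv[OF that] by (simp add: has_vector_derivative_def)
  from has_derivative_zero_constant[OF is_interval_convex[OF assms] this] show thesis
    using that by blast
qed

lemma energy_constant: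
  assumes "is_interval J"
  obtains h where "\<And>t. t \<in> J \<Longrightarrow> energy \<kappa> n m (q t) (p t) = h"
proof -
  have "((\<lambda>t. energy \<kappa> n m (q t) (p t)) has_derivative (\<lambda>h. 0)) (at t within J)"
    if "t \<in> J" for t
    using energy_deriv[OF that] by (simp add: has_field_derivative_def lambda_zero)
  from has_derivative_zero_constant[OF is_interval_convex[OF assms] this] show thesis
    using that by blast
qed

lemma polar_moment_tendsto_0:
  assumes "total_collision_at_north_pole \<kappa> n q ts"
  shows "((\<lambda>t. polar_moment \<kappa> n m (q t)) \<longlongrightarrow> 0) (at_left ts)"
proof -
  have "((\<lambda>t. polar_moment \<kappa> n m (q t)) \<longlongrightarrow>
      (\<Sum>a\<in>{1..n}. m a * ((1 / sqrt \<kappa> - north_pole \<kappa> $ 3) / sqrt \<kappa>))) (at_left ts)"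
    unfolding polar_moment_def using assms curvature_pos
    by (intro tendsto_intros) (auto simp: total_collision_at_north_pole_def)
  then show ?thesis by (simp add: north_pole_def)
qed

lemma eventually_near_pole:
  assumes "total_collision_at_north_pole \<kappa> n q ts"
  shows "\<forall>\<^sub>F t in at_left ts. (\<forall>a\<in>{1..n}. sqrt \<kappa> * q t a $ 3 \<ge> 7/8) \<and>
    (\<forall>a\<in>{1..n}. \<forall>b\<in>{1..n}. \<kappa> * (q t a \<bullet> q t b) \<ge> 9/10)"
proof (intro eventually_conj eventually_ball_finite ballI finite_atLeastAtMost)
  have lim: "((\<lambda>t. q t a) \<longlongrightarrow> north_pole \<kappa>) (at_left ts)" if "a \<in> {1..n}" for a
    using assms that by (auto simp: total_collision_at_north_pole_def)
  fix a assume a: "a \<in> {1..n}"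
  have "((\<lambda>t. sqrt \<kappa> * q t a $ 3) \<longlongrightarrow> sqrt \<kappa> * north_pole \<kappa> $ 3) (at_left ts)"
    by (intro tendsto_intros lim a)
  moreover have "sqrt \<kappa> * north_pole \<kappa> $ 3 > 7/8"
    using curvature_pos by (simp add: north_pole_def)
  ultimately show "\<forall>\<^sub>F t in at_left ts. sqrt \<kappa> * q t a $ 3 \<ge> 7/8"
    by (rule eventually_mono[OF order_tendstoD(1) less_imp_le])
  fix b assume b: "b \<in> {1..n}"
  have "((\<lambda>t. \<kappa> * (q t a \<bullet> q t b)) \<longlongrightarrow> \<kappa> * (north_pole \<kappa> \<bullet> north_pole \<kappa>)) (at_left ts)"
    by (intro tendsto_intros lim a b)
  moreover have "\<kappa> * (north_pole \<kappa> \<bullet> north_pole \<kappa>) > 9/10"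
    using curvature_pos by (simp add: north_pole_def inner_vec_def sum_3)
  ultimately show "\<forall>\<^sub>F t in at_left ts. \<kappa> * (q t a \<bullet> q t b) \<ge> 9/10"
    by (rule eventually_mono[OF order_tendstoD(1) less_imp_le])
qed

lemma polar_angular_momentum_eq_0:
  assumes J: "is_interval J" "{t0..<ts} \<subseteq> J" "t0 < ts"
    and collision: "total_collision_at_north_pole \<kappa> n q ts"
    and const: "\<And>t. t \<in> J \<Longrightarrow> angular_momentum n (q t) (p t) $ 3 = \<gamma>"
  shows "\<gamma> = 0"
proof (rule ccontr)
  assume "\<gamma> \<noteq> 0"
  let ?D = "\<lambda>t. polar_moment \<kappa> n m (q t)"
  obtain h where h: "\<And>t. t \<in> J \<Longrightarrow> energy \<kappa> n m (q t) (p t) = h"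
    using energy_constant[OF J(1)] by blast
  obtain e where e: "e < ts" and near: "\<And>t. e < t \<Longrightarrow> t < ts \<Longrightarrow>
      (\<forall>a\<in>{1..n}. sqrt \<kappa> * q t a $ 3 \<ge> 7/8) \<and>
      (\<forall>a\<in>{1..n}. \<forall>b\<in>{1..n}. \<kappa> * (q t a \<bullet> q t b) \<ge> 9/10)"
    using eventually_near_pole[OF collision] by (auto simp: eventually_at_left_field)
  \<comment> \<open>Times after \<open>u\<close> are interior to \<open>J\<close>, so that one-sided derivatives do not occur.\<close>
  define u where "u = max t0 e"
  have in_J: "t \<in> J" and at_J: "at t within J = at t" if "u < t" "t < ts" for t
  proof -
    have "{t0<..<ts} \<subseteq> J" using J(2) by auto
    then show "t \<in> J" "at t within J = at t"
      using that at_within_open_subset[of t "{t0<..<ts}" J] by (auto simp: u_def)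
  qed
  have moment_pos: "?D t > 0"
    and ineq: "\<gamma>\<^sup>2 \<le> 4 * ?D t * kinetic_energy n m (p t)" if "t \<in> J" for t
  proof -
    show ineq: "\<gamma>\<^sup>2 \<le> 4 * ?D t * kinetic_energy n m (p t)"
      using angular_momentum_square_le[OF that] const[OF that] by simp
    then show "?D t > 0"
      using polar_moment_nonneg[OF that] \<open>\<gamma> \<noteq> 0\<close>
      by (cases "?D t = 0") auto
  qed
  show False
  proof (rule no_collapse_of_repulsion)
    show "u < ts" using e J(3) by (simp add: u_def)
    show "\<gamma>\<^sup>2 / 8 > 0" using \<open>\<gamma> \<noteq> 0\<close> by simp
    show "(?D \<longlongrightarrow> 0) (at_left ts)" by (rule polar_moment_tendsto_0[OF collision])
    fix t assume t: "u < t" "t < ts"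
    show "(?D has_real_derivative - (\<Sum>a\<in>{1..n}. p t a $ 3) / sqrt \<kappa>) (at t)"
      using polar_moment_deriv[OF in_J[OF t]] by (simp only: at_J[OF t])
    show "((\<lambda>s. - (\<Sum>a\<in>{1..n}. p s a $ 3) / sqrt \<kappa>) has_real_derivative polar_acceleration t) (at t)"
      using polar_moment_deriv2[OF in_J[OF t]] by (simp only: at_J[OF t])
    show "?D t > 0" by (rule moment_pos[OF in_J[OF t]])
    have "\<gamma>\<^sup>2 / 8 / ?D t \<le> (1/2) * kinetic_energy n m (p t)"
      using ineq[OF in_J[OF t]] moment_pos[OF in_J[OF t]] by (simp add: divide_simps mult_ac)
    moreover have "(1/2) * kinetic_energy n m (p t) + (5/4) * h \<le> polar_acceleration t"
      using polar_acceleration_ge[OF in_J[OF t]] near[of t] t h[OF in_J[OF t]] by (auto simp: u_def)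
    ultimately show "polar_acceleration t \<ge> \<gamma>\<^sup>2 / 8 / ?D t - (- (5/4) * h)" by simp
  qed
qed

end

theorem theorem3:
  fixes \<kappa> t0 ts :: real and n :: nat and m :: "nat \<Rightarrow> real"
    and J :: "real set" and q p :: "real \<Rightarrow> nat \<Rightarrow> real^3"
  assumes "\<kappa> > 0" and "n \<ge> 2" and "\<And>i. i \<in> {1..n} \<Longrightarrow> m i > 0"
    and "is_interval J" and "t0 < ts" and "{t0..<ts} \<subseteq> J" and "J \<subseteq> {..<ts}"
    and "curved_nbody_solution \<kappa> n m J q p"
    and "\<And>t i. t \<in> J \<Longrightarrow> i \<in> {1..n} \<Longrightarrow> q t i $ 3 > 0"
    and "\<And>i. i \<in> {1..n} \<Longrightarrow> real_analytic_on (\<lambda>t. q t i) J"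
    and "\<And>i. i \<in> {1..n} \<Longrightarrow> real_analytic_on (\<lambda>t. p t i) J"
    and "total_collision_at_north_pole \<kappa> n q ts"
    and "\<And>t. t \<in> {t0..<ts} \<Longrightarrow> \<not> pole_geodesic_configuration n (q t)"
  shows "\<exists>\<alpha> \<beta> \<gamma>. (\<forall>t\<in>J. angular_momentum n (q t) (p t) = vector [\<alpha>, \<beta>, \<gamma>]) \<and> \<gamma> = 0"
proof -
  interpret curved_motion \<kappa> n m J q p
    by unfold_locales (use assms in auto)
  obtain c where c: "\<And>t. t \<in> J \<Longrightarrow> angular_momentum n (q t) (p t) = c"
    using angular_momentum_constant[OF assms(4)] by blast
  have "c $ 3 = 0"
    by (rule polar_angular_momentum_eq_0[OF assms(4,6,5,12)]) (simp add: c)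
  moreover have "c = vector [c $ 1, c $ 2, c $ 3]"
    by (simp add: vec_eq_iff forall_3)
  ultimately show ?thesis
    using c by (intro exI[of _ "c $ 1"] exI[of _ "c $ 2"] exI[of _ "c $ 3"]) simp
qed

end
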